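(* Every word of length $78$ over the binary alphabet $\{a,b\}$ that contains neither $aaaa$ nor $bb$ as a factor contains an abelian $5$-power. This bound is tight: the word $$aaababababaaababababaaabaaabaaabaaababababaaabaaabaaabaaababababaaababababaaa$$ of length $77$ contains neither $aaaa$ nor $bb$ as a factor and does not contain an abelian $5$-power.
   Context: A factor of a word is a contiguous subword. A word contains an abelian $k$-power if it has a factor of the form $v_1v_2\cdots v_k$ where $v_1,\dots,v_k$ are non-empty words that are permutations (anagrams) of one another. *)

theory Defs
  imports "HOL-Library.Multiset" "HOL-Library.Sublist"
begin

datatype letter = a | b

(* sublist in HOL-Library.Sublist is the contiguous-subword relation, i.e. "is a factor of";
   two words are permutations (anagrams) of one another iff their letter multisets agree. *)
definition contains_abelian_power :: "nat \<Rightarrow> 'l list \<Rightarrow> bool" where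
  "contains_abelian_power k w \<longleftrightarrow>
     (\<exists>vs. length vs = k \<and>
           (\<forall>v \<in> set vs. v \<noteq> []) \<and>
           (\<forall>u \<in> set vs. \<forall>v \<in> set vs. mset u = mset v) \<and>
           sublist (concat vs) w)"

definition tight_word :: "letter list" where
  "tight_word =
     [a,a,a,b,a,b,a,b,a,b,a,a,a,b,a,b,a,b,a,b,
      a,a,a,b,a,a,a,b,a,a,a,b,a,a,a,b,a,b,a,b,
      a,b,a,a,a,b,a,a,a,b,a,a,a,b,a,a,a,b,a,b,
      a,b,a,b,a,a,a,b,a,b,a,b,a,b,a,a,a]"

end

theory Submission
  imports Defs
begin

text \<open>
  Over a binary alphabet two words are anagrams iff they have the same length and the same number
  of \<open>b\<close>s, so abelian powers can be detected by counting. The first half then follows from an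
  exhaustive search: words are extended on the left, and a branch is cut as soon as the current word
  begins with \<open>bb\<close>, \<open>aaaa\<close> or an abelian fifth power. All branches are cut by depth 78
  after only a few thousand nodes, so the search can be evaluated by rewriting.
\<close>

lemma length_conv_count_list_letters: "length w = count_list w a + count_list w b"
proof (induction w)
  case (Cons x w)
  then show ?case by (cases x) auto
qed simp

lemma mset_letters_eq_iff:
  "mset u = mset v \<longleftrightarrow> length u = length v \<and> count_list u b = count_list v b"
proof
  assume "mset u = mset v"
  then show "length u = length v \<and> count_list u b = count_list v b"
    by (metis mset_eq_length count_mset)
next
  assume *: "length u = length v \<and> count_list u b = count_list v b"
  then have "count_list u a = count_list v a"
    using length_conv_count_list_letters[of u] length_conv_count_list_letters[of v] by simp
  with * have "count_list u x = count_list v x" for x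
    by (cases x) simp_all
  then show "mset u = mset v"
    by (simp add: multiset_eq_iff count_mset)
qed

text \<open>
  \<open>blocks_from k M C m c w\<close>: \<open>w\<close> begins with the rest of a partially read block, namely \<open>m\<close>
  letters containing \<open>c\<close> times \<open>b\<close>, followed by \<open>k\<close> blocks of length \<open>M\<close> with \<open>C\<close> times \<open>b\<close>.
  Pure pattern matching on constructors keeps evaluation by rewriting fast.
\<close>

fun blocks_from :: "nat \<Rightarrow> nat \<Rightarrow> nat \<Rightarrow> nat \<Rightarrow> nat \<Rightarrow> letter list \<Rightarrow> bool" where
  "blocks_from 0 M C 0 0 w = True"
| "blocks_from (Suc k) M C 0 0 w = blocks_from k M C M C w"
| "blocks_from k M C 0 (Suc c) w = False"
| "blocks_from k M C (Suc m) c [] = False"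
| "blocks_from k M C (Suc m) c (a # w) = blocks_from k M C m c w"
| "blocks_from k M C (Suc m) (Suc c) (b # w) = blocks_from k M C m c w"
| "blocks_from k M C (Suc m) 0 (b # w) = False"

text \<open>The unfinished block \<open>u\<close> is stated for the induction; at
  \<open>m = c = 0\<close> it is empty, leaving \<open>k\<close> complete blocks.\<close>

lemma blocks_from_sound:
  assumes "blocks_from k M C m c w"
  obtains u vs where "length u = m" "count_list u b = c" "length vs = k"
    "\<And>v. v \<in> set vs \<Longrightarrow> length v = M \<and> count_list v b = C" "prefix (u @ concat vs) w"
  using assms
proof (induction k M C m c w arbitrary: thesis rule: blocks_from.induct)
  case (1 M C w)
  show ?case by (rule 1(1)[of "[]" "[]"]) auto
next
  case (2 k M C w)
  have "blocks_from k M C M C w" using 2(3) by simp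
  then obtain u vs where "length u = M" "count_list u b = C" "length vs = k"
    "\<And>v. v \<in> set vs \<Longrightarrow> length v = M \<and> count_list v b = C" "prefix (u @ concat vs) w"
    using 2(1) by blast
  \<comment> \<open>The block opened by this equation becomes the first of the complete
    ones.\<close>
  then show ?case by (intro 2(2)[of "[]" "u # vs"]) auto
next
  case (5 k M C m c w)
  have "blocks_from k M C m c w" using 5(3) by simp
  then obtain u vs where "length u = m" "count_list u b = c" "length vs = k"
    "\<And>v. v \<in> set vs \<Longrightarrow> length v = M \<and> count_list v b = C" "prefix (u @ concat vs) w"
    using 5(1) by blast
  then show ?case by (intro 5(2)[of "a # u" vs]) auto
next
  case (6 k M C m c w)
  have "blocks_from k M C m c w" using 6(3) by simp
  then obtain u vs where "length u = m" "count_list u b = c" "length vs = k"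
    "\<And>v. v \<in> set vs \<Longrightarrow> length v = M \<and> count_list v b = C" "prefix (u @ concat vs) w"
    using 6(1) by blast
  then show ?case by (intro 6(2)[of "b # u" vs]) auto
qed simp_all

text \<open>The counters match \<open>u\<close> exactly, so no rejecting equation applies before
  \<open>u\<close> is used up.\<close>

lemma blocks_from_append:
  "blocks_from k M C (length u) (count_list u b) (u @ w) = blocks_from k M C 0 0 w"
proof (induction u)
  case (Cons x u)
  then show ?case by (cases x) auto
qed simp

lemma blocks_from_complete:
  assumes "\<And>v. v \<in> set vs \<Longrightarrow> length v = M \<and> count_list v b = C"
  shows "blocks_from (length vs) M C 0 0 (concat vs @ w)"
  using assms
proof (induction vs)
  case (Cons v vs)
  then show ?case
    using blocks_from_append[of "length vs" M C v "concat vs @ w"] by auto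
qed simp

text \<open>
  The arguments \<open>m\<close> and \<open>c\<close> of \<open>power_from\<close> are the length and the number of \<open>b\<close>s of the part of
  the first block already read; \<open>n\<close> bounds the number of further letters of that block.
\<close>

fun power_from :: "nat \<Rightarrow> nat \<Rightarrow> nat \<Rightarrow> nat \<Rightarrow> letter list \<Rightarrow> bool" where
  "power_from k 0 m c w = False"
| "power_from k (Suc n) m c [] = False"
| "power_from k (Suc n) m c (a # w) =
     (blocks_from k (Suc m) c 0 0 w \<or> power_from k n (Suc m) c w)"
| "power_from k (Suc n) m c (b # w) =
     (blocks_from k (Suc m) (Suc c) 0 0 w \<or> power_from k n (Suc m) (Suc c) w)"

lemma power_from_sound:
  assumes "power_from k n m c w"
  obtains u v where "w = u @ v" "u \<noteq> []"
    "blocks_from k (m + length u) (c + count_list u b) 0 0 v"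
  using assms
proof (induction k n m c w arbitrary: thesis rule: power_from.induct)
  case (3 k n m c w)
  show ?case
  \<comment> \<open>Either the first block ends with this letter or it goes on.\<close>
  proof (cases "blocks_from k (Suc m) c 0 0 w")
    case True
    then show ?thesis by (intro 3(2)[of "[a]" w]) auto
  next
    case False
    then have "power_from k n (Suc m) c w" using 3(3) by simp
    then obtain u v where "w = u @ v"
      "blocks_from k (Suc m + length u) (c + count_list u b) 0 0 v"
      using 3(1) by blast
    then show ?thesis by (intro 3(2)[of "a # u" v]) auto
  qed
next
  case (4 k n m c w)
  show ?case
  proof (cases "blocks_from k (Suc m) (Suc c) 0 0 w")
    case True
    then show ?thesis by (intro 4(2)[of "[b]" w]) auto
  next
    case False
    then have "power_from k n (Suc m) (Suc c) w" using 4(3) by simp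
    then obtain u v where "w = u @ v"
      "blocks_from k (Suc m + length u) (Suc c + count_list u b) 0 0 v"
      using 4(1) by blast
    then show ?thesis by (intro 4(2)[of "b # u" v]) auto
  qed
qed simp_all

lemma power_from_complete:
  assumes "u \<noteq> []" "length u \<le> n"
    and "blocks_from k (m + length u) (c + count_list u b) 0 0 v"
  shows "power_from k n m c (u @ v)"
  using assms
proof (induction u arbitrary: n m c)
  case (Cons x u)
  then obtain n' where n: "n = Suc n'" "length u \<le> n'"
    by (cases n) auto
  show ?case
  proof (cases "u = []")
    case True
    with Cons.prems n show ?thesis by (cases x) auto
  next
    case False
    with Cons.IH[of n' "Suc m" "c + (if x = b then 1 else 0)"] Cons.prems n
    show ?thesis by (cases x) auto
  qed
qed simp

lemma power_from_imp_contains_abelian_power: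
  assumes "power_from k n 0 0 w"
  shows "contains_abelian_power (Suc k) w"
proof -
  obtain u v where w: "w = u @ v" "u \<noteq> []"
    and "blocks_from k (length u) (count_list u b) 0 0 v"
    using power_from_sound[OF assms] by auto
  then obtain vs where vs: "length vs = k" "prefix (concat vs) v"
    and anagrams: "\<And>x. x \<in> set vs \<Longrightarrow> length x = length u \<and> count_list x b = count_list u b"
    by (elim blocks_from_sound) auto
  \<comment> \<open>No block is empty, as all share the length of the non-empty
    \<open>u\<close>.\<close>
  have "\<forall>x\<in>set (u # vs). x \<noteq> [] \<and> mset x = mset u"
    using w(2) anagrams by (fastforce simp: mset_letters_eq_iff)
  moreover have "sublist (concat (u # vs)) w"
    using vs(2) w(1) by (simp add: prefix_imp_sublist)
  ultimately show ?thesis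
    unfolding contains_abelian_power_def using vs(1)
    by (intro exI[of _ "u # vs"]) auto
qed

text \<open>A power may start anywhere, hence the suffixes; its first block is no longer than
  \<open>w\<close>. This reduces power-freeness of a concrete word to a computation.\<close>

lemma contains_abelian_power_imp_power_from:
  assumes "contains_abelian_power (Suc k) w"
  shows "\<exists>v\<in>set (suffixes w). power_from k (length w) 0 0 v"
proof -
  obtain u vs where vs: "length vs = k" "u \<noteq> []" "sublist (u @ concat vs) w"
    and anagrams: "\<And>x. x \<in> set vs \<Longrightarrow> mset x = mset u"
    using assms unfolding contains_abelian_power_def
    by (auto simp: length_Suc_conv)
  from vs(3) obtain p s where w: "w = p @ u @ concat vs @ s"
    by (auto simp: sublist_def)
  have "blocks_from k (length u) (count_list u b) 0 0 (concat vs @ s)"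
    using blocks_from_complete[of vs] anagrams vs(1) by (auto simp: mset_letters_eq_iff)
  then have "power_from k (length w) 0 0 (u @ concat vs @ s)"
    using vs(2) w by (intro power_from_complete) auto
  moreover have "u @ concat vs @ s \<in> set (suffixes w)"
    using w by (auto simp: suffix_def)
  ultimately show ?thesis by blast
qed

text \<open>A fifth power in a word of length at most 78 has blocks of length at most 15.\<close>

definition dead :: "letter list \<Rightarrow> bool" where
  "dead w \<longleftrightarrow> prefix [b, b] w \<or> prefix [a, a, a, a] w \<or> power_from 4 15 0 0 w"

fun all_dead :: "nat \<Rightarrow> letter list \<Rightarrow> bool" where
  "all_dead 0 w \<longleftrightarrow> dead w"
| "all_dead (Suc n) w \<longleftrightarrow> dead w \<or> all_dead n (a # w) \<and> all_dead n (b # w)"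

lemma dead_imp:
  assumes "dead v" "suffix v w"
  shows "sublist [b, b] w \<or> sublist [a, a, a, a] w \<or> contains_abelian_power 5 w"
proof -
  have "sublist x w" if "sublist x v" for x
    using that suffix_imp_sublist[OF assms(2)] by (rule sublist_order.order_trans)
  then have "contains_abelian_power 5 w" if "contains_abelian_power 5 v"
    using that unfolding contains_abelian_power_def by blast
  moreover have "contains_abelian_power 5 v" if "power_from 4 15 0 0 v"
    using power_from_imp_contains_abelian_power[OF that] by simp
  ultimately show ?thesis
    using assms(1) \<open>\<And>x. sublist x v \<Longrightarrow> sublist x w\<close> unfolding dead_def by blast
qed

text \<open>The search branch that prepends the letters of \<open>u\<close> from right to left
  passes only through suffixes of \<open>u @ w\<close>, and it must meet a dead one. Reverse
  induction peels off the letter next to \<open>w\<close>, which is the one prepended first.\<close>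

lemma all_dead_imp_dead_suffix:
  assumes "all_dead (length u) w"
  shows "\<exists>v. suffix v (u @ w) \<and> dead v"
  using assms
proof (induction u arbitrary: w rule: rev_induct)
  case Nil
  then show ?case by auto
next
  case (snoc x u)
  show ?case
  proof (cases "dead w")
    case True
    then show ?thesis unfolding suffix_def by blast
  next
    case False
    then have "all_dead (length u) (x # w)"
      using snoc.prems by (cases x) auto
    then show ?thesis using snoc.IH by fastforce
  qed
qed

lemma all_dead_78: "all_dead 78 []"
  by code_simp

lemma tight_word_power_free: "\<not> contains_abelian_power 5 tight_word"
proof
  assume "contains_abelian_power 5 tight_word"
  \<comment> \<open>\<open>list_ex\<close> makes the bounded quantifier executable; 4 counts the
    blocks after the first.\<close>
  then have "list_ex (power_from 4 (length tight_word) 0 0) (suffixes tight_word)"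
    using contains_abelian_power_imp_power_from[of 4 tight_word] by (simp add: list_ex_iff)
  moreover have "\<not> list_ex (power_from 4 (length tight_word) 0 0) (suffixes tight_word)"
    by code_simp
  ultimately show False by contradiction
qed

theorem proposition4p3:
  shows "(\<forall>w :: letter list.
            length w = 78 \<and> \<not> sublist [a, a, a, a] w \<and> \<not> sublist [b, b] w
              \<longrightarrow> contains_abelian_power 5 w) \<and>
         (length tight_word = 77 \<and>
          \<not> sublist [a, a, a, a] tight_word \<and> \<not> sublist [b, b] tight_word \<and>
          \<not> contains_abelian_power 5 tight_word)"
proof (intro conjI allI impI)
  fix w :: "letter list"
  assume w: "length w = 78 \<and> \<not> sublist [a, a, a, a] w \<and> \<not> sublist [b, b] w"
  then obtain v where "suffix v w" "dead v"
    \<comment> \<open>The search starts from the empty suffix of \<open>w\<close>.\<close>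
    using all_dead_imp_dead_suffix[of w "[]"] all_dead_78 by auto
  with w show "contains_abelian_power 5 w"
    using dead_imp by blast
next
  show "length tight_word = 77"
    by (simp add: tight_word_def)
  show "\<not> sublist [a, a, a, a] tight_word" "\<not> sublist [b, b] tight_word"
    by code_simp+
qed (rule tight_word_power_free)

end
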